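(* For each even integer $k\geqslant0$, $$\delta\Big(\sum_{\mathbf{a}\in\mathcal{A}_k}(-1)^{\mathrm{depth}(\mathbf{a})}[\mathbf{a}]\Big)=\sum_{\mathbf{a}\in\mathcal{A}_k^{\rm even}}(-3)^{\mathrm{depth}(\mathbf{a})}\,\mathbf{a},$$ where $\mathcal{A}_k^{\rm even}$ is the set of admissible compositions of weight $k$ all of whose entries are even.
   Context: A composition is a finite sequence $\mathbf{a}=(a_1,\ldots,a_r)$ of positive integers ($r\geqslant0$), of depth $r$ and weight $\sum a_i$; admissible if $r=0$ or $a_1\geqslant2$. $\mathcal{A}$ (resp. $\mathcal{A}_k$) is the set of admissible compositions (resp. of weight $k$). Binary word $\mathbf{w}(\mathbf{a})=0^{a_1-1}1\cdots0^{a_r-1}1$; the dual of a word $\varepsilon_1\cdots\varepsilon_k$ is $\overline{\varepsilon_k}\cdots\overline{\varepsilon_1}$ ($\overline0=1,\overline1=0$); $\overline{\mathbf{a}}$ is the admissible composition with word dual to $\mathbf{w}(\mathbf{a})$. $\mathcal{B}=\mathcal{A}/(\mathbf{a}\sim\overline{\mathbf{a}})$, classes $[\mathbf{a}]$, $\mathcal{B}_k$ classes of weight $k$; $\mathbf{Z}^{(X)}$ is the free $\mathbf{Z}$-module on $X$. $(a_1,\ldots,a_r)^{\rm init}=(a_1,\ldots,a_{r-1})$ ($\varnothing^{\rm init}=\varnothing$); for admissible $\mathbf{a}$, $\mathbf{a}^{\rm fin}$ is the dual of $(\overline{\mathbf{a}})^{\rm init}$ and $\mathbf{a}^{\rm mid}=(\mathbf{a}^{\rm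 fin})^{\rm init}$; extended $\mathbf{Z}$-linearly. $\delta$ is the unique $\mathbf{Z}$-linear map $\mathbf{Z}^{(\mathcal{B})}\to\mathbf{Z}^{(\mathcal{A})}$ with $\delta(\mathbf{Z}^{\mathcal{B}_k})\subset\mathbf{Z}^{\mathcal{A}_k}$ for all $k$, $\delta([\varnothing])=\varnothing$, and $\delta([\mathbf{a}])^{\rm init}=\delta([\mathbf{a}^{\rm init}])+\delta([\mathbf{a}^{\rm mid}])+\delta([\mathbf{a}^{\rm fin}])$ for all non-empty admissible $\mathbf{a}$. *)

theory Defs
  imports Complex_Main "HOL-Library.Poly_Mapping"
begin

section \<open>Admissible compositions\<close>

definition composition :: "nat list \<Rightarrow> bool" where
  "composition a \<longleftrightarrow> (\<forall>n \<in> set a. n > 0)"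

definition admissible :: "nat list \<Rightarrow> bool" where
  "admissible a \<longleftrightarrow> composition a \<and> (a = [] \<or> hd a \<ge> 2)"

typedef acomp = "{a :: nat list. admissible a}"
  morphisms entries Acomp
  by (rule exI[of _ "[]"]) (simp add: admissible_def composition_def)

setup_lifting type_definition_acomp

lift_definition empty_comp :: acomp is "[]"
  by (simp add: admissible_def composition_def)

lift_definition depth :: "acomp \<Rightarrow> nat" is length .

lift_definition weight :: "acomp \<Rightarrow> nat" is sum_list .

definition \<A> :: "nat \<Rightarrow> acomp set" where
  "\<A> k = {a. weight a = k}"

definition \<A>_even :: "nat \<Rightarrow> acomp set" where
  "\<A>_even k = {a \<in> \<A> k. \<forall>n \<in> set (entries a). even n}"


section \<open>Binary words and duality\<close>

text \<open>The letter 0 is encoded as \<^term>\<open>False\<close> and the letter 1 as \<^term>\<open>True\<close>.\<close>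

definition word_of :: "nat list \<Rightarrow> bool list" where
  "word_of a = concat (map (\<lambda>n. replicate (n - 1) False @ [True]) a)"

definition dual_word :: "bool list \<Rightarrow> bool list" where
  "dual_word w = rev (map Not w)"

lift_definition word :: "acomp \<Rightarrow> bool list" is word_of .

definition dual :: "acomp \<Rightarrow> acomp" where
  "dual a = (THE b. word b = dual_word (word a))"

primrec unword :: "nat \<Rightarrow> bool list \<Rightarrow> nat list" where
  "unword n [] = []"
| "unword n (b # w) = (if b then Suc n # unword 0 w else unword (Suc n) w)"

lemma unword_replicate: "unword n (replicate m False @ True # w) = Suc (n + m) # unword 0 w"
  by (induction m arbitrary: n) auto

lemma word_of_simps [simp]:
  "word_of [] = []" "word_of (n # a) = replicate (n - 1) False @ True # word_of a"
  by (simp_all add: word_of_def)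

lemma unword_word_of: "composition a \<Longrightarrow> unword 0 (word_of a) = a"
  by (induction a) (auto simp: composition_def unword_replicate)

lemma word_of_unword:
  "w \<noteq> [] \<Longrightarrow> last w \<Longrightarrow> word_of (unword n w) = replicate n False @ w"
proof (induction w arbitrary: n)
  case (Cons b w)
  show ?case
  proof (cases "w = []")
    case False
    with Cons have "last w" by simp
    with Cons.IH False have "word_of (unword m w) = replicate m False @ w" for m by blast
    then show ?thesis
      by (simp add: replicate_app_Cons_same)
  qed (use Cons in auto)
qed simp

lemma composition_unword: "composition (unword n w)"
  by (induction w arbitrary: n) (auto simp: composition_def)

definition adm_word :: "bool list \<Rightarrow> bool" where
  "adm_word w \<longleftrightarrow> w = [] \<or> (\<not> hd w \<and> last w)"

lemma last_word_of: "a \<noteq> [] \<Longrightarrow> word_of a \<noteq> [] \<and> last (word_of a)"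
  by (cases a rule: rev_cases) (auto simp: word_of_def)

lemma adm_word_of: "admissible a \<Longrightarrow> adm_word (word_of a)"
proof (cases a)
  case (Cons n b)
  assume "admissible a"
  with Cons have "n \<ge> 2" by (simp add: admissible_def)
  then obtain m where "n = Suc (Suc m)" by (metis add_2_eq_Suc le_Suc_ex)
  with Cons last_word_of[of a] show ?thesis by (simp add: adm_word_def)
qed (simp add: adm_word_def)

lemma admissible_unword:
  assumes "adm_word w" shows "admissible (unword 0 w)"
proof (cases "w = []")
  case False
  then obtain v where v: "w = False # v"
    using assms by (cases w) (auto simp: adm_word_def)
  have "unword (Suc m) v \<noteq> [] \<longrightarrow> hd (unword (Suc m) v) \<ge> 2" for m
    by (induction v arbitrary: m) auto
  then show ?thesis using composition_unword[of 0 w] by (auto simp: admissible_def v)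
qed (simp add: admissible_def composition_def)

lemma word_inj: "word a = word b \<longleftrightarrow> a = b"
  by transfer (metis admissible_def unword_word_of)

lemma adm_word_word [simp]: "adm_word (word a)"
  by transfer (rule adm_word_of)

lemma ex_word: "adm_word w \<Longrightarrow> \<exists>a. word a = w"
proof transfer
  fix w assume "adm_word w"
  then show "\<exists>a\<in>Collect admissible. word_of a = w"
    using admissible_unword[of w] word_of_unword[of w 0]
    by (intro bexI[of _ "unword 0 w"]; cases "w = []") (auto simp: adm_word_def)
qed

lemma adm_dual_word: "adm_word w \<Longrightarrow> adm_word (dual_word w)"
  by (auto simp: adm_word_def dual_word_def hd_rev last_rev last_map hd_map)

lemma dual_ex1: "\<exists>!b. word b = dual_word (word a)"
  using ex_word[OF adm_dual_word[OF adm_word_word[of a]]] word_inj by metis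

lemma word_dual: "word (dual a) = dual_word (word a)"
  unfolding dual_def by (rule theI'[OF dual_ex1])

lemma dual_word_dual_word [simp]: "dual_word (dual_word w) = w"
  by (simp add: dual_word_def rev_map comp_def)

lemma dual_dual [simp]: "dual (dual a) = a"
  by (simp add: word_dual flip: word_inj)

quotient_type bcomp = acomp / "\<lambda>a b. b = a \<or> b = dual a"
  morphisms rep_bcomp cls
  by (rule equivpI) (auto intro!: reflpI sympI transpI)

definition \<B> :: "nat \<Rightarrow> bcomp set" where
  "\<B> k = cls ` \<A> k"


section \<open>Initial, final and middle parts\<close>

lemma admissible_butlast: "admissible a \<Longrightarrow> admissible (butlast a)"
  by (cases a) (auto simp: admissible_def composition_def dest: in_set_butlastD)

lift_definition init :: "acomp \<Rightarrow> acomp" is butlast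
  by (rule admissible_butlast)

definition fin :: "acomp \<Rightarrow> acomp" where
  "fin a = dual (init (dual a))"

definition mid :: "acomp \<Rightarrow> acomp" where
  "mid a = init (fin a)"


section \<open>Free modules and the map \<open>\<delta>\<close>\<close>

text \<open>The free \<open>\<int>\<close>-module on a type \<open>'a\<close> is \<^typ>\<open>'a \<Rightarrow>\<^sub>0 int\<close>, with basis vectors
  \<^term>\<open>frag_of\<close> and scalar multiplication \<^term>\<open>frag_cmul\<close>; the set below is its submodule
  spanned by \<open>X\<close>.\<close>

definition free_on :: "'a set \<Rightarrow> ('a \<Rightarrow>\<^sub>0 int) set" where
  "free_on X = {x. Poly_Mapping.keys x \<subseteq> X}"

definition init_lin :: "(acomp \<Rightarrow>\<^sub>0 int) \<Rightarrow> (acomp \<Rightarrow>\<^sub>0 int)" where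
  "init_lin = frag_extend (\<lambda>a. frag_of (init a))"

definition is_delta :: "((bcomp \<Rightarrow>\<^sub>0 int) \<Rightarrow> (acomp \<Rightarrow>\<^sub>0 int)) \<Rightarrow> bool" where
  "is_delta d \<longleftrightarrow>
     module_hom frag_cmul frag_cmul d \<and>
     (\<forall>k. d ` free_on (\<B> k) \<subseteq> free_on (\<A> k)) \<and>
     d (frag_of (cls empty_comp)) = frag_of empty_comp \<and>
     (\<forall>a. a \<noteq> empty_comp \<longrightarrow>
        init_lin (d (frag_of (cls a))) =
          d (frag_of (cls (init a))) + d (frag_of (cls (mid a))) + d (frag_of (cls (fin a))))"

definition delta :: "(bcomp \<Rightarrow>\<^sub>0 int) \<Rightarrow> (acomp \<Rightarrow>\<^sub>0 int)" where
  "delta = (THE d. is_delta d)"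


section \<open>Existence and uniqueness of \<open>\<delta>\<close>\<close>

lemma weight_word: "weight a = length (word a)"
proof transfer
  fix a assume "admissible a"
  then have "composition a" by (simp add: admissible_def)
  then show "sum_list a = length (word_of a)"
    by (induction a) (auto simp: composition_def)
qed

lemma finite_A: "finite (\<A> k)"
proof -
  have "word ` \<A> k \<subseteq> {w. set w \<subseteq> UNIV \<and> length w = k}"
    by (auto simp: \<A>_def weight_word)
  then have "finite (word ` \<A> k)"
    using finite_lists_length_eq[of "UNIV :: bool set" k] finite_subset by auto
  then show ?thesis
    by (rule finite_imageD) (simp add: inj_on_def word_inj)
qed

lemma finite_A_even: "finite (\<A>_even k)"
  by (simp add: \<A>_even_def finite_A)

lemma weight_dual [simp]: "weight (dual a) = weight a"
  by (simp add: weight_word word_dual dual_word_def)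

lemma weight_init_eq: "a \<noteq> empty_comp \<Longrightarrow> weight a = weight (init a) + last (entries a)"
proof transfer
  fix a :: "nat list" assume "a \<noteq> []"
  then show "sum_list a = sum_list (butlast a) + last a"
    by (cases a rule: rev_cases) simp_all
qed

lemma last_entries_pos: "a \<noteq> empty_comp \<Longrightarrow> last (entries a) > 0"
  by transfer (simp add: admissible_def composition_def)

lemma weight_init_less: "a \<noteq> empty_comp \<Longrightarrow> weight (init a) < weight a"
  using weight_init_eq last_entries_pos by fastforce

lemma weight_empty [simp]: "weight empty_comp = 0"
  by transfer simp

lemma weight_eq_0: "weight a = 0 \<longleftrightarrow> a = empty_comp"
  using weight_init_less[of a] by (metis not_less_zero weight_empty)

lemma init_empty [simp]: "init empty_comp = empty_comp"
  by transfer simp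

lemma weight_init_le: "weight (init a) \<le> weight a"
  by (cases "a = empty_comp") (simp_all add: less_imp_le weight_init_less)

lemma weight_ge_2: "a \<noteq> empty_comp \<Longrightarrow> weight a \<ge> 2"
  by transfer (auto simp: admissible_def neq_Nil_conv)

lemma dual_empty_iff [simp]: "dual a = empty_comp \<longleftrightarrow> a = empty_comp"
  by (metis weight_dual weight_eq_0)

lemma weight_fin_less: "a \<noteq> empty_comp \<Longrightarrow> weight (fin a) < weight a"
  using weight_init_less[of "dual a"] by (simp add: fin_def)

lemma weight_mid_less: "a \<noteq> empty_comp \<Longrightarrow> weight (mid a) < weight a"
  using weight_fin_less[of a] weight_init_le[of "fin a"] by (simp add: mid_def)

definition init_word :: "bool list \<Rightarrow> bool list" where
  "init_word w = rev (dropWhile Not (tl (rev w)))"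

definition fin_word :: "bool list \<Rightarrow> bool list" where
  "fin_word w = dropWhile id (tl w)"

lemma word_of_snoc: "word_of (a @ [n]) = word_of a @ replicate (n - 1) False @ [True]"
  by (simp add: word_of_def)

lemma word_init: "word (init a) = init_word (word a)"
proof transfer
  fix a :: "nat list"
  show "word_of (butlast a) = init_word (word_of a)"
  proof (cases a rule: rev_cases)
    case (snoc b n)
    have "dropWhile Not (replicate m False @ rev (word_of b)) = rev (word_of b)" for m
    proof (induction m)
      case 0
      show ?case
        by (cases "b = []"; cases "word_of b" rule: rev_cases) (use last_word_of[of b] in auto)
    qed simp
    then show ?thesis by (simp add: snoc init_word_def word_of_snoc)
  qed (simp add: init_word_def)
qed

lemma word_fin: "word (fin a) = fin_word (word a)"
proof -
  have "dropWhile Not (map Not v) = map Not (dropWhile id v)" for v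
    by (simp add: dropWhile_map comp_def id_def)
  then show ?thesis
    by (simp add: fin_def word_dual word_init dual_word_def init_word_def fin_word_def rev_map
        comp_def flip: map_tl)
qed

lemma dropWhile_both_ends:
  assumes "\<And>x. \<not> (P x \<and> Q x)"
  shows "dropWhile P (rev (dropWhile Q (rev u))) = rev (dropWhile Q (rev (dropWhile P u)))"
proof (induction u)
  case (Cons x u)
  show ?case
  proof (cases "P x")
    case True
    with assms have "\<not> Q x" by blast
    then have "rev (dropWhile Q (rev (x # u))) = x # rev (dropWhile Q (rev u))"
      by (auto simp: dropWhile_append)
    with True Cons show ?thesis by simp
  next
    case False
    then show ?thesis
      by (auto simp: dropWhile_append)
  qed
qed simp

lemma init_fin_word:
  assumes "adm_word w"
  shows "init_word (fin_word w) = fin_word (init_word w)"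
proof (cases "w = []")
  case False
  with assms obtain v where "w = False # v" "last w"
    by (metis adm_word_def list.collapse)
  then obtain u where w: "w = False # u @ [True]"
    by (cases v rule: rev_cases) auto
  have 1: "fin_word w = (if \<forall>x\<in>set u. x then [] else dropWhile id u @ [True])"
    by (auto simp: fin_word_def w dropWhile_append)
  have 2: "init_word w =
      (if \<forall>x\<in>set u. \<not> x then [] else False # rev (dropWhile Not (rev u)))"
    by (auto simp: init_word_def w dropWhile_append)
  have 3: "dropWhile id (rev (dropWhile Not (rev u))) = rev (dropWhile Not (rev (dropWhile id u)))"
    by (rule dropWhile_both_ends) simp
  have 4: "dropWhile id u = []" if "\<forall>x\<in>set u. x" using that by simp
  have 5: "dropWhile Not (rev u) = []" if "\<forall>x\<in>set u. \<not> x" using that by simp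
  have "init_word (fin_word w) = rev (dropWhile Not (rev (dropWhile id u)))"
    by (cases "\<forall>x\<in>set u. x") (simp_all only: 1 4 if_True if_False, simp_all add: init_word_def)
  moreover have "fin_word (init_word w) = dropWhile id (rev (dropWhile Not (rev u)))"
    by (cases "\<forall>x\<in>set u. \<not> x") (simp_all only: 2 5 if_True if_False, simp_all add: fin_word_def)
  ultimately show ?thesis using 3 by simp
qed (simp add: init_word_def fin_word_def)

lemma init_fin: "init (fin a) = fin (init a)"
  using init_fin_word[of "word a"] by (simp add: word_init word_fin flip: word_inj)

lemma init_dual: "init (dual a) = dual (fin a)"
  by (simp add: fin_def)

lemma fin_dual: "fin (dual a) = dual (init a)"
  by (simp add: fin_def)

lemma mid_dual: "mid (dual a) = dual (mid a)"
  by (simp add: mid_def fin_dual init_dual init_fin)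

text \<open>Right inverse of \<^term>\<open>init\<close> on compositions of weight less than \<open>k\<close>,
  with values of weight \<open>k\<close>.\<close>

definition extend :: "nat \<Rightarrow> acomp \<Rightarrow> acomp" where
  "extend k a = Acomp (entries a @ [k - weight a])"

lemma entries_extend:
  assumes "weight a < k" "2 \<le> k"
  shows "entries (extend k a) = entries a @ [k - weight a]"
proof -
  have "admissible (entries a @ [k - weight a])"
    using entries[of a] assms
    by (auto simp: admissible_def composition_def hd_append weight.rep_eq)
  then show ?thesis by (simp add: extend_def Acomp_inverse)
qed

lemma init_extend: "weight a < k \<Longrightarrow> 2 \<le> k \<Longrightarrow> init (extend k a) = a"
  by (simp add: entries_extend init.rep_eq flip: entries_inject)

lemma weight_extend: "weight a < k \<Longrightarrow> 2 \<le> k \<Longrightarrow> weight (extend k a) = k"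
  by (simp add: entries_extend weight.rep_eq)

lemma extend_init:
  assumes "a \<noteq> empty_comp" shows "extend (weight a) (init a) = a"
proof -
  have "entries a \<noteq> []" using assms by (metis empty_comp.rep_eq entries_inject)
  then show ?thesis
    using weight_init_eq[OF assms] weight_init_less[OF assms] weight_ge_2[OF assms]
    by (simp add: entries_extend init.rep_eq flip: entries_inject)
qed

function delta0 :: "acomp \<Rightarrow> (acomp \<Rightarrow>\<^sub>0 int)" where
  "delta0 a = (if a = empty_comp then frag_of empty_comp else
     frag_extend (\<lambda>c. frag_of (extend (weight a) c))
       (delta0 (init a) + delta0 (mid a) + delta0 (fin a)))"
  by auto
termination
  by (relation "Wellfounded.measure weight")
    (auto simp: weight_init_less weight_fin_less weight_mid_less)

declare delta0.simps [simp del]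

lemma delta0_dual: "delta0 (dual a) = delta0 a"
proof (induction a rule: delta0.induct)
  case (1 a)
  show ?case
  proof (cases "a = empty_comp")
    case True
    then show ?thesis by (metis dual_empty_iff)
  next
    case False
    then show ?thesis
      using 1 by (simp add: delta0.simps[of a] delta0.simps[of "dual a"]
          init_dual fin_dual mid_dual add_ac)
  qed
qed

lemma keys_add3:
  "Poly_Mapping.keys (x + y + z) \<subseteq> Poly_Mapping.keys x \<union> Poly_Mapping.keys y \<union> Poly_Mapping.keys z"
  using keys_add[of "x + y" z] keys_add[of x y] by blast

lemma keys_delta0: "c \<in> Poly_Mapping.keys (delta0 a) \<Longrightarrow> weight c = weight a"
proof (induction a arbitrary: c rule: delta0.induct)
  case (1 a)
  show ?case
  proof (cases "a = empty_comp")
    case True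
    with 1(4) show ?thesis by (simp add: delta0.simps[of empty_comp])
  next
    case False
    let ?s = "delta0 (init a) + delta0 (mid a) + delta0 (fin a)"
    obtain b where b: "b \<in> Poly_Mapping.keys ?s" "c = extend (weight a) b"
      using 1(4) False keys_frag_extend[of "\<lambda>c. frag_of (extend (weight a) c)" ?s]
      by (auto simp: delta0.simps[of a])
    have "weight b < weight a"
      using subsetD[OF keys_add3 b(1)] 1(1-3)[OF False] weight_init_less[OF False]
        weight_mid_less[OF False] weight_fin_less[OF False] by auto
    then show ?thesis using b(2) weight_extend weight_ge_2[OF False] by simp
  qed
qed

lemma frag_extend_id_on:
  assumes "\<And>c. c \<in> Poly_Mapping.keys x \<Longrightarrow> f c = c"
  shows "frag_extend (\<lambda>c. frag_of (f c)) x = x"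
  using assms frag_expansion[of x] frag_extend_eq[of x "\<lambda>c. frag_of (f c)" frag_of] by simp

lemma init_delta0:
  assumes "a \<noteq> empty_comp"
  shows "init_lin (delta0 a) = delta0 (init a) + delta0 (mid a) + delta0 (fin a)" (is "_ = ?s")
proof -
  have less: "weight c < weight a" if "c \<in> Poly_Mapping.keys ?s" for c
    using subsetD[OF keys_add3 that] keys_delta0[of c] weight_init_less[OF assms]
      weight_mid_less[OF assms] weight_fin_less[OF assms] by auto
  have "init_lin (delta0 a) = frag_extend (\<lambda>c. frag_of (init (extend (weight a) c))) ?s"
    using assms frag_extend_compose[of "\<lambda>a. frag_of (init a)" "extend (weight a)"]
    by (simp add: init_lin_def delta0.simps[of a] comp_def fun_eq_iff)
  also have "\<dots> = ?s"
    by (rule frag_extend_id_on) (use less init_extend weight_ge_2[OF assms] in simp)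
  finally show ?thesis .
qed

lemma module_frag_cmul: "module (frag_cmul :: int \<Rightarrow> ('a \<Rightarrow>\<^sub>0 int) \<Rightarrow> _)"
  by unfold_locales (simp_all add: frag_cmul_distrib frag_cmul_distrib2)

lemma delta_exists: "\<exists>d. is_delta d"
proof -
  define f where "f b = delta0 (rep_bcomp b)" for b
  have f: "f (cls a) = delta0 a" for a
  proof -
    have "rep_bcomp (cls a) = a \<or> rep_bcomp (cls a) = dual a"
      using Quotient3_abs_rep[OF Quotient3_bcomp, of "cls a"]
      by (metis bcomp.abs_eq_iff dual_dual)
    then show ?thesis by (auto simp: f_def delta0_dual)
  qed
  have "frag_extend f x \<in> free_on (\<A> k)" if "x \<in> free_on (\<B> k)" for x k
  proof -
    have "weight c = k" if c: "c \<in> Poly_Mapping.keys (frag_extend f x)" for c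
    proof -
      obtain b where b: "b \<in> Poly_Mapping.keys x" "c \<in> Poly_Mapping.keys (f b)"
        using subsetD[OF keys_frag_extend c] by blast
      then obtain a where "b = cls a" "weight a = k"
        using \<open>x \<in> free_on (\<B> k)\<close> by (auto simp: free_on_def \<A>_def \<B>_def)
      with b f keys_delta0 show ?thesis by simp
    qed
    then show ?thesis by (auto simp: free_on_def \<A>_def)
  qed
  then have "is_delta (frag_extend f)"
    unfolding is_delta_def
    by (auto simp: f init_delta0 delta0.simps[of empty_comp] module_hom_def module_hom_axioms_def
        module_frag_cmul frag_extend_add frag_extend_cmul)
  then show ?thesis by blast
qed

lemma extend_init_lin:
  assumes "x \<in> free_on (\<A> k)" "k > 0"
  shows "frag_extend (\<lambda>c. frag_of (extend k c)) (init_lin x) = x"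
proof -
  have "frag_extend (\<lambda>c. frag_of (extend k c)) (init_lin x) =
      frag_extend (\<lambda>c. frag_of (extend k (init c))) x"
    using frag_extend_compose[of "\<lambda>c. frag_of (extend k c)" init]
    by (simp add: init_lin_def comp_def fun_eq_iff)
  also have "\<dots> = x"
  proof (rule frag_extend_id_on)
    fix c assume "c \<in> Poly_Mapping.keys x"
    then have "weight c = k" using assms by (auto simp: free_on_def \<A>_def)
    then show "extend k (init c) = c" using assms(2) extend_init[of c] by (metis less_irrefl weight_empty)
  qed
  finally show ?thesis .
qed

lemma is_delta_eq_delta0:
  assumes "is_delta d" shows "d (frag_of (cls a)) = delta0 a"
proof (induction a rule: delta0.induct)
  case (1 a)
  show ?case
  proof (cases "a = empty_comp")
    case True
    with assms show ?thesis by (simp add: is_delta_def delta0.simps)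
  next
    case False
    have "frag_of (cls a) \<in> free_on (\<B> (weight a))"
      by (auto simp: free_on_def \<B>_def \<A>_def)
    then have "d (frag_of (cls a)) \<in> free_on (\<A> (weight a))"
      using assms by (auto simp: is_delta_def)
    then have "d (frag_of (cls a)) =
        frag_extend (\<lambda>c. frag_of (extend (weight a) c)) (init_lin (d (frag_of (cls a))))"
      using extend_init_lin weight_ge_2[OF False] by simp
    also have "\<dots> = delta0 a"
      using assms False 1 by (simp add: is_delta_def delta0.simps[of a])
    finally show ?thesis .
  qed
qed

lemma delta_unique:
  assumes "is_delta d" "is_delta e" shows "d = e"
proof
  fix x :: "bcomp \<Rightarrow>\<^sub>0 int"
  interpret d: module_hom frag_cmul frag_cmul d using assms by (simp add: is_delta_def)
  interpret e: module_hom frag_cmul frag_cmul e using assms by (simp add: is_delta_def)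
  have "Poly_Mapping.keys x \<subseteq> UNIV" by simp
  then show "d x = e x"
  proof (induction x rule: frag_induction)
    case (one b)
    obtain a where "b = cls a" using Quotient3_abs_rep[OF Quotient3_bcomp, of b, symmetric] ..
    then show ?case using is_delta_eq_delta0[OF assms(1)] is_delta_eq_delta0[OF assms(2)] by simp
  qed (simp_all add: d.diff e.diff)
qed

lemma delta_ex1: "\<exists>!d. is_delta d"
  using delta_exists delta_unique by blast

lemma is_delta_delta: "is_delta delta"
  unfolding delta_def by (rule theI'[OF delta_ex1])

end

theory Submission
  imports Defs
begin

text \<open>Put \<open>S\<^sub>k = \<Sum>\<^bsub>a \<in> \<A> k\<^esub> (-1)\<^bsup>depth a\<^esup> \<delta>[a]\<close>. Duality preserves
  \<open>\<delta>[a]\<close> and multiplies \<open>(-1)\<^bsup>depth a\<^esup>\<close> by \<open>(-1)\<^bsup>k\<^esup>\<close>, so \<open>S\<^sub>k = 0\<close> for odd \<open>k\<close>. For \<open>k \<ge> 2\<close>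
  removing the last entry is a bijection from \<open>\<A> k\<close> onto the union of the \<open>\<A> j\<close> with \<open>j < k\<close> which
  lowers the depth by one. Hence for even \<open>k \<ge> 2\<close> the \<open>init\<close> terms of the recursion for \<open>\<delta>\<close> sum to
  \<open>- \<Sum>\<^bsub>j<k\<^esub> S\<^sub>j\<close>, by duality so do the \<open>fin\<close> terms, and applying both facts to
  \<open>mid = fin \<circ> init\<close> the \<open>mid\<close> terms telescope to the same value. Thus \<open>S\<^sub>k\<close>
  has \<open>init\<close> part \<open>-3 \<Sum>\<^bsub>j<k\<^esub> S\<^sub>j\<close>, the same recursion as for the right-hand side of the theorem.\<close>

section \<open>Sums over compositions of fixed weight\<close>

text \<open>\<open>init\<close> and \<open>extend k\<close> are mutually inverse here;
  \<open>2 \<le> k\<close> keeps the one-entry composition \<open>[k]\<close> admissible.\<close>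

lemma sum_A_extend:
  fixes g :: "acomp \<Rightarrow> 'b::comm_monoid_add"
  assumes "2 \<le> k"
  shows "(\<Sum>a\<in>\<A> k. g a) = (\<Sum>j<k. \<Sum>b\<in>\<A> j. g (extend k b))"
proof -
  have "(\<Sum>a\<in>\<A> k. g a) = (\<Sum>b\<in>(\<Union>j<k. \<A> j). g (extend k b))"
  proof (rule sum.reindex_bij_witness[of _ "extend k" init])
    fix a assume a: "a \<in> \<A> k"
    then have w: "weight a = k" by (simp add: \<A>_def)
    with assms have ne: "a \<noteq> empty_comp" by auto
    show ext: "extend k (init a) = a" using extend_init[OF ne] w by simp
    show "init a \<in> (\<Union>j<k. \<A> j)" using weight_init_less[OF ne] w by (simp add: \<A>_def)
    show "g (extend k (init a)) = g a" by (simp add: ext)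
  next
    fix b assume "b \<in> (\<Union>j<k. \<A> j)"
    then have "weight b < k" by (auto simp: \<A>_def)
    with assms show "init (extend k b) = b" "extend k b \<in> \<A> k"
      by (simp_all add: init_extend weight_extend \<A>_def)
  qed
  also have "\<dots> = (\<Sum>j<k. \<Sum>b\<in>\<A> j. g (extend k b))"
    by (rule sum.UNION_disjoint) (auto simp: finite_A, auto simp: \<A>_def)
  finally show ?thesis .
qed

lemma depth_extend: "weight a < k \<Longrightarrow> 2 \<le> k \<Longrightarrow> depth (extend k a) = Suc (depth a)"
  by (simp add: depth.rep_eq entries_extend)

lemma depth_word: "depth a = length (filter id (word a))"
proof transfer
  fix a :: "nat list"
  show "length a = length (filter id (word_of a))"
    by (induction a) auto
qed

text \<open>Depth counts the ones of the word, and duality exchanges ones and zeros.\<close>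

lemma depth_dual: "depth (dual a) + depth a = weight a"
  using sum_length_filter_compl[of id "word a"]
  by (simp add: depth_word weight_word word_dual dual_word_def rev_filter[symmetric] filter_map comp_def id_def)

text \<open>\<open>F\<close> is left arbitrary so that the same rules apply to \<open>delta0\<close>
  and to its composites with \<open>init\<close>, \<open>fin\<close> and \<open>mid\<close>.\<close>

definition alt_sum :: "nat \<Rightarrow> (acomp \<Rightarrow> 'a \<Rightarrow>\<^sub>0 int) \<Rightarrow> ('a \<Rightarrow>\<^sub>0 int)" where
  "alt_sum k F = (\<Sum>a\<in>\<A> k. frag_cmul ((-1) ^ depth a) (F a))"

lemma alt_sum_add: "alt_sum k (\<lambda>a. F a + G a) = alt_sum k F + alt_sum k G"
  by (simp add: alt_sum_def frag_cmul_distrib2 sum.distrib)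

lemma alt_sum_0: "alt_sum 0 F = F empty_comp"
proof -
  have "\<A> 0 = {empty_comp}" by (auto simp: \<A>_def weight_eq_0)
  moreover have "depth empty_comp = 0" by transfer simp
  ultimately show ?thesis by (simp add: alt_sum_def)
qed

lemma alt_sum_1: "alt_sum (Suc 0) F = 0"
proof -
  have "\<A> (Suc 0) = {}"
    by (auto simp: \<A>_def) (metis One_nat_def Suc_1 Suc_n_not_le_n weight_empty weight_ge_2 zero_neq_one)
  then show ?thesis by (simp add: alt_sum_def)
qed

lemma alt_sum_init:
  assumes "2 \<le> k"
  shows "alt_sum k (\<lambda>a. F (init a)) = - (\<Sum>j<k. alt_sum j F)"
  unfolding alt_sum_def sum_A_extend[OF assms] sum_negf[symmetric]
  by (intro sum.cong refl) (use assms in \<open>auto simp: \<A>_def init_extend depth_extend\<close>)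

lemma alt_sum_dual: "alt_sum k (\<lambda>a. F (dual a)) = frag_cmul ((-1) ^ k) (alt_sum k F)"
proof -
  have "alt_sum k (\<lambda>a. F (dual a)) = (\<Sum>a\<in>\<A> k. frag_cmul ((-1) ^ depth (dual a)) (F a))"
    unfolding alt_sum_def by (rule sum.reindex_bij_witness[of _ dual dual]) (auto simp: \<A>_def)
  also have "\<dots> = (\<Sum>a\<in>\<A> k. frag_cmul ((-1) ^ k) (frag_cmul ((-1) ^ depth a) (F a)))"
  proof (rule sum.cong[OF refl])
    fix a assume "a \<in> \<A> k"
    then have "k = depth (dual a) + depth a" by (simp add: \<A>_def depth_dual)
    then show "frag_cmul ((-1) ^ depth (dual a)) (F a) =
        frag_cmul ((-1) ^ k) (frag_cmul ((-1) ^ depth a) (F a))"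
      by (simp add: power_add mult.assoc flip: power_mult_distrib)
  qed
  also have "\<dots> = frag_cmul ((-1) ^ k) (alt_sum k F)"
    by (simp add: alt_sum_def frag_cmul_sum)
  finally show ?thesis .
qed

section \<open>Recursion for the signed sum\<close>

lemma alt_sum_delta0_odd:
  assumes "odd k"
  shows "alt_sum k delta0 = 0"
proof -
  have "alt_sum k delta0 = alt_sum k (\<lambda>a. delta0 (dual a))"
    by (simp add: delta0_dual)
  also have "\<dots> = - alt_sum k delta0"
    unfolding alt_sum_dual using assms by simp
  finally have "alt_sum k delta0 + alt_sum k delta0 = 0"
    by (simp only: eq_neg_iff_add_eq_0)
  \<comment> \<open>Integer coefficients have no 2-torsion, so the sum itself vanishes.\<close>
  then have "Poly_Mapping.lookup (alt_sum k delta0 + alt_sum k delta0) x = 0" for x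
    by simp
  then show ?thesis by (intro poly_mapping_eqI) (simp add: lookup_add)
qed

lemma alt_sum_delta0_fin:
  assumes "2 \<le> k"
  shows "alt_sum k (\<lambda>a. delta0 (fin a)) = frag_cmul ((-1) ^ Suc k) (\<Sum>j<k. alt_sum j delta0)"
proof -
  have "alt_sum k (\<lambda>a. delta0 (fin a)) = alt_sum k (\<lambda>a. delta0 (init (dual a)))"
    by (simp add: fin_def delta0_dual)
  also have "\<dots> = frag_cmul ((-1) ^ k) (- (\<Sum>j<k. alt_sum j delta0))"
    by (simp add: alt_sum_dual[of k "\<lambda>a. delta0 (init a)"] alt_sum_init[OF assms])
  also have "\<dots> = frag_cmul ((-1) ^ Suc k) (\<Sum>j<k. alt_sum j delta0)"
    by (rule poly_mapping_eqI) simp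
  finally show ?thesis .
qed

text \<open>Weights are added in pairs. Write \<open>S j\<close> for \<open>alt_sum j delta0\<close>
  and \<open>P j\<close> for the sum of \<open>S i\<close> over \<open>i < j\<close>. For even
  \<open>j \<ge> 2\<close>, the \<open>fin\<close> sums at \<open>j\<close> and \<open>j + 1\<close>
  are \<open>- P j\<close> and \<open>P j + S j\<close>, with total \<open>S j\<close>; and
  \<open>S (j + 1) = 0\<close>.\<close>

lemma sum_alt_sum_delta0_fin:
  "(\<Sum>j<2 * Suc m. alt_sum j (\<lambda>a. delta0 (fin a))) = (\<Sum>j<2 * Suc m. alt_sum j delta0)"
proof (induction m)
  case 0
  have "fin empty_comp = empty_comp"
    by (metis dual_empty_iff fin_def init_empty)
  then show ?case by (simp add: numeral_2_eq_2 alt_sum_0 alt_sum_1)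
next
  case (Suc m)
  have "2 * Suc (Suc m) = Suc (Suc (2 * Suc m))" by simp
  then show ?case
    using Suc by (simp add: alt_sum_delta0_fin alt_sum_delta0_odd)
qed

lemma init_lin_sum: "init_lin (sum f A) = (\<Sum>a\<in>A. init_lin (f a))"
  by (cases "finite A") (auto simp: init_lin_def frag_extend_sum)

lemma init_lin_cmul: "init_lin (frag_cmul c x) = frag_cmul c (init_lin x)"
  by (simp add: init_lin_def frag_extend_cmul)

lemma init_lin_alt_sum_delta0:
  assumes "even k" "k > 0"
  shows "init_lin (alt_sum k delta0) = frag_cmul (-3) (\<Sum>j<k. alt_sum j delta0)" (is "_ = frag_cmul _ ?P")
proof -
  obtain m where m: "k = 2 * Suc m"
    using assms by (metis evenE gr0_implies_Suc nat_0_less_mult_iff)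
  then have k: "2 \<le> k" by simp
  have "init_lin (alt_sum k delta0) =
      alt_sum k (\<lambda>a. delta0 (init a) + delta0 (mid a) + delta0 (fin a))"
    unfolding alt_sum_def init_lin_sum init_lin_cmul
  proof (intro sum.cong refl arg_cong2[where f = frag_cmul] init_delta0)
    fix a assume "a \<in> \<A> k"
    with k show "a \<noteq> empty_comp" by (auto simp: \<A>_def)
  qed
  also have "\<dots> = alt_sum k (\<lambda>a. delta0 (init a)) + alt_sum k (\<lambda>a. delta0 (fin (init a)))
      + alt_sum k (\<lambda>a. delta0 (fin a))"
    by (simp add: alt_sum_add mid_def init_fin)
  also have "alt_sum k (\<lambda>a. delta0 (init a)) = - ?P"
    by (rule alt_sum_init[OF k])
  \<comment> \<open>Removing the outer \<open>init\<close> leaves the \<open>fin\<close> sums of all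
    weights below \<open>k\<close>, an even bound as the telescoping needs.\<close>
  also have "alt_sum k (\<lambda>a. delta0 (fin (init a))) = - ?P"
    using alt_sum_init[OF k, of "\<lambda>a. delta0 (fin a)"] sum_alt_sum_delta0_fin[of m] by (simp only: m)
  also have "alt_sum k (\<lambda>a. delta0 (fin a)) = - ?P"
    using alt_sum_delta0_fin[OF k] assms by simp
  also have "- ?P + - ?P + - ?P = frag_cmul (-3) ?P"
    by (rule poly_mapping_eqI) (simp add: lookup_minus)
  finally show ?thesis .
qed

section \<open>Recursion for the sum over even compositions\<close>

definition even_sum :: "nat \<Rightarrow> (acomp \<Rightarrow>\<^sub>0 int)" where
  "even_sum k = (\<Sum>a\<in>\<A>_even k. frag_cmul ((-3) ^ depth a) (frag_of a))"

lemma even_weight: "\<forall>n\<in>set (entries a). even n \<Longrightarrow> even (weight a)"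
proof transfer
  fix a :: "nat list"
  assume "\<forall>n\<in>set a. even n"
  then show "even (sum_list a)" by (induction a) auto
qed

lemma even_sum_odd: "odd k \<Longrightarrow> even_sum k = 0"
  using even_weight by (auto simp: even_sum_def \<A>_even_def \<A>_def intro!: sum.neutral)

lemma even_sum_0: "even_sum 0 = frag_of empty_comp"
proof -
  have "entries empty_comp = []" by transfer simp
  then have "\<A>_even 0 = {empty_comp}" "depth empty_comp = 0"
    by (auto simp: \<A>_even_def \<A>_def weight_eq_0 depth.rep_eq)
  then show ?thesis by (simp add: even_sum_def)
qed

text \<open>The appended entry is \<open>k - weight b\<close>, which is even as soon as all entries
  of \<open>b\<close> are.\<close>

lemma even_entries_extend:
  assumes "even k" "weight b < k" "2 \<le> k"
  shows "(\<forall>n\<in>set (entries (extend k b)). even n) \<longleftrightarrow> (\<forall>n\<in>set (entries b). even n)"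
  using assms even_weight[of b] by (auto simp: entries_extend)

lemma init_lin_even_sum:
  assumes "even k" "k > 0"
  shows "init_lin (even_sum k) = frag_cmul (-3) (\<Sum>j<k. even_sum j)"
proof -
  let ?ev = "\<lambda>a. \<forall>n\<in>set (entries a). even n"
  have k: "2 \<le> k" using assms by (auto elim!: evenE)
  \<comment> \<open>Parity moves into the summand so that \<open>sum_A_extend\<close>
    applies.\<close>
  have filt: "sum h (\<A>_even j) = (\<Sum>a\<in>\<A> j. if ?ev a then h a else 0)"
    for j and h :: "acomp \<Rightarrow> acomp \<Rightarrow>\<^sub>0 int"
    unfolding \<A>_even_def by (rule sum.inter_filter[OF finite_A])
  have "init_lin (even_sum k) =
      (\<Sum>a\<in>\<A>_even k. frag_cmul ((-3) ^ depth a) (frag_of (init a)))"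
    unfolding even_sum_def init_lin_sum init_lin_cmul by (simp add: init_lin_def)
  also have "\<dots> = (\<Sum>j<k. \<Sum>b\<in>\<A> j. if ?ev b
      then frag_cmul (-3) (frag_cmul ((-3) ^ depth b) (frag_of b)) else 0)"
    unfolding filt sum_A_extend[OF k]
    by (intro sum.cong refl if_cong)
      (use assms k in \<open>auto simp: \<A>_def even_entries_extend init_extend depth_extend\<close>)
  also have "\<dots> = frag_cmul (-3) (\<Sum>j<k. even_sum j)"
    unfolding even_sum_def filt[symmetric] by (simp only: frag_cmul_sum)
  finally show ?thesis .
qed

section \<open>Comparison of the two sums\<close>

lemma cmul_in_free_on: "x \<in> free_on X \<Longrightarrow> frag_cmul c x \<in> free_on X"
  using keys_cmul[of c x] by (auto simp: free_on_def)

lemma sum_in_free_on: "(\<And>a. a \<in> A \<Longrightarrow> f a \<in> free_on X) \<Longrightarrow> sum f A \<in> free_on X"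
  using keys_sum[of f A] by (fastforce simp: free_on_def)

lemma alt_sum_delta0_eq_even_sum: "alt_sum k delta0 = even_sum k"
proof (induction k rule: less_induct)
  case (less k)
  consider "odd k" | "k = 0" | "even k" "k > 0" by blast
  then show ?case
  proof cases
    case 1
    then show ?thesis by (simp add: alt_sum_delta0_odd even_sum_odd)
  next
    case 2
    then show ?thesis by (simp add: alt_sum_0 even_sum_0 delta0.simps[of empty_comp])
  next
    case 3
    have "alt_sum k delta0 \<in> free_on (\<A> k)"
      unfolding alt_sum_def
      by (intro sum_in_free_on cmul_in_free_on) (auto simp: free_on_def \<A>_def dest: keys_delta0)
    moreover have "even_sum k \<in> free_on (\<A> k)"
      unfolding even_sum_def
      by (intro sum_in_free_on cmul_in_free_on) (auto simp: free_on_def \<A>_even_def)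
    moreover have "init_lin (alt_sum k delta0) = init_lin (even_sum k)"
      using 3 less by (simp add: init_lin_alt_sum_delta0 init_lin_even_sum)
    \<comment> \<open>In positive weight \<open>k\<close>, \<open>extend k\<close> recovers an
      element from its \<open>init_lin\<close>, so equal images force equality.\<close>
    ultimately show ?thesis using 3(2) extend_init_lin by metis
  qed
qed

theorem theorem13:
  fixes k :: nat
  assumes "even k"
  shows "delta (\<Sum>a\<in>\<A> k. frag_cmul ((-1) ^ depth a) (frag_of (cls a))) =
         (\<Sum>a\<in>\<A>_even k. frag_cmul ((-3) ^ depth a) (frag_of a))"
proof -
  interpret module_hom frag_cmul frag_cmul delta
    using is_delta_delta by (simp add: is_delta_def)
  have "delta (\<Sum>a\<in>\<A> k. frag_cmul ((-1) ^ depth a) (frag_of (cls a))) = alt_sum k delta0"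
    by (simp add: sum scale alt_sum_def is_delta_eq_delta0[OF is_delta_delta])
  then show ?thesis by (simp add: alt_sum_delta0_eq_even_sum even_sum_def)
qed

end
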